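(* Let $\mu$ be the standard V-monotone Gaussian measure and let $\gamma_0=\dfrac{2}{e^{2\sqrt3\pi/9}-1}$. The reciprocal Cauchy--Stieltjes transform $F_\mu$ of $\mu$ is given by $$F_\mu(x)=x\,T_0^{-1}(W(x))\qquad\text{for } x\in\mathbb{R}\setminus[-\sqrt{2+\gamma_0},\sqrt{2+\gamma_0}].$$
   Context: The measure $\mu$. Let $(C_n)_{n\ge0}$ be the Catalan numbers and define polynomials $P_n(s)$, $s\in[0,1]$, by $P_0(s)=1$ and $P_{n+1}(s)=\sum_{m=0}^{n}\Big(\int_0^s P_m(t)\,dt+2^{-m}C_m(1-s)^{m+1}\Big)P_{n-m}(s)$ for $n\ge0$. Put $m_n=P_{n/2}(1)$ if $n$ is even and $m_n=0$ if $n$ is odd. It is known that $|P_n(s)|\le C_n$ and that $(m_n)_{n\ge0}$ is the moment sequence of a (unique, compactly supported) probability measure $\mu$ on $\mathbb{R}$, called the standard V-monotone Gaussian measure. Its Cauchy--Stieltjes transform is $G_\mu(z)=\int_{\mathbb{R}}\frac{\mu(dt)}{z-t}$ for $z\in\mathbb{C}\setminus\operatorname{supp}\mu$, and its reciprocal Cauchy--Stieltjes transform is $F_\mu=1/G_\mu$ (considered here for real arguments). The function $T_0:[0,\infty)\to\mathbb{R}$ is given by $T_0(s)=-\frac{\sqrt3}{3}\Big(\arctan\big(\frac{2s-1}{\sqrt3}\big)-\frac{\pi}{6}\Big)-\frac{\ln(s^2-s+1)}{2}=\int_s^1\frac{t}{t^2-t+1}\,dt$. It is strictly decreasing with range $(-\infty,\sqrt3\pi/9]$,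 and $T_0^{-1}:(-\infty,\sqrt3\pi/9]\to[0,\infty)$ is its inverse. The function $W:\mathbb{R}\setminus[-\sqrt2,\sqrt2]\to\mathbb{R}$ is $W(x)=\frac12\ln\big(1+\frac{2}{x^2-2}\big)$. *)

theory Defs
  imports "HOL-Probability.Probability"
begin

definition catalan :: "nat \<Rightarrow> real" where
  "catalan n = real ((2 * n) choose n) / real (n + 1)"

(* Only arguments s in [0,1] are meaningful; there V_poly n is a polynomial function. *)
fun V_poly :: "nat \<Rightarrow> real \<Rightarrow> real" where
  "V_poly 0 s = 1"
| "V_poly (Suc n) s =
     (\<Sum>m\<in>{0..n}. (integral {0..s} (\<lambda>t. V_poly m t) + catalan m / 2 ^ m * (1 - s) ^ (m + 1))
                  * V_poly (n - m) s)"

definition V_gaussian_moment :: "nat \<Rightarrow> real" where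
  "V_gaussian_moment n = (if even n then V_poly (n div 2) 1 else 0)"

(* The moments determine the measure uniquely and force its support to be compact,
   so neither property is part of the definition. *)
definition standard_V_monotone_gaussian :: "real measure \<Rightarrow> bool" where
  "standard_V_monotone_gaussian \<mu> \<longleftrightarrow>
     real_distribution \<mu> \<and>
     (\<forall>n. integrable \<mu> (\<lambda>t. t ^ n) \<and> (\<integral>t. t ^ n \<partial>\<mu>) = V_gaussian_moment n)"

definition measure_support :: "real measure \<Rightarrow> real set" where
  "measure_support \<mu> = {x. \<forall>U. open U \<and> x \<in> U \<longrightarrow> emeasure \<mu> U > 0}"

(* Meaningful for z outside the (closed) support of \<mu>. *)
definition cauchy_stieltjes :: "real measure \<Rightarrow> complex \<Rightarrow> complex" where
  "cauchy_stieltjes \<mu> z = (\<integral>t. 1 / (z - complex_of_real t) \<partial>\<mu>)"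

definition reciprocal_cauchy_stieltjes :: "real measure \<Rightarrow> complex \<Rightarrow> complex" where
  "reciprocal_cauchy_stieltjes \<mu> z = 1 / cauchy_stieltjes \<mu> z"

(* On {0..} this is the integral of t / (t^2 - t + 1) from s to 1. *)
definition T0 :: "real \<Rightarrow> real" where
  "T0 s = - (sqrt 3 / 3) * (arctan ((2 * s - 1) / sqrt 3) - pi / 6) - ln (s\<^sup>2 - s + 1) / 2"

(* T0 is a bijection from {0..} onto {..sqrt 3 * pi / 9}; the inverse is meaningful there. *)
definition T0_inv :: "real \<Rightarrow> real" where
  "T0_inv = inv_into {0..} T0"

(* Meaningful for \<bar>x\<bar> > sqrt 2. *)
definition W :: "real \<Rightarrow> real" where
  "W x = 1 / 2 * ln (1 + 2 / (x\<^sup>2 - 2))"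

definition gamma0 :: real where
  "gamma0 = 2 / (exp (2 * sqrt 3 * pi / 9) - 1)"

end

theory Submission
  imports Defs
begin

text \<open>
  Let f(s) be the sum of the P_n(s) z^n and r(s) = sqrt (1 - 2 z (1 - s)). Summing the Catalan part
  of the recursion turns it into 1 / f(s) = r(s) - z * (integral of f over [0, s]). The substitution
  1 / f = r u separates the variables of this equation and gives
  T0 (u(s)) = (ln (1 - 2 z (1 - s)) - ln (1 - 2 z)) / 2, hence T0 (1 / f(1)) = W(x) for z = 1 / x^2.
  The bound |P_n| <= C_n only yields convergence for z < 1/4. For all z < 1 / (2 + gamma0) it follows
  from positivity: the explicit solution built from T0_inv exists on the whole of [0, 1] and dominates
  the partial sums by induction. The growth of the moments then confines the support of \<mu>, and the
  Cauchy-Stieltjes transform at x is the moment series.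
\<close>

section \<open>Catalan numbers and the binomial series of the square root\<close>

lemma catalan_nonneg: "0 \<le> catalan n"
  by (simp add: catalan_def)

lemma catalan_Suc: "real (n + 2) * catalan (Suc n) = real (4 * n + 2) * catalan n"
proof -
  have fact_eq: "real ((2 * k) choose k) = fact (2 * k) / (fact k * fact k)" for k
    using binomial_fact[of k "2 * k", where ?'a = real] by (simp add: mult_2)
  have "(fact (2 * Suc n) :: real) = real (2 * n + 2) * (real (2 * n + 1) * fact (2 * n))"
    by (simp add: algebra_simps)
  then show ?thesis
    unfolding catalan_def fact_eq by (simp add: divide_simps) (simp add: algebra_simps)
qed

text \<open>Both sides satisfy the same first-order recurrence (n + 2) a(n + 1) = (4 n + 2) a(n) and
  agree at n = 0. This identifies the binomial series of the square root with the Catalan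
  series.\<close>

lemma gbinomial_half_Suc_catalan:
  "((1 / 2 :: real) gchoose Suc n) * (- 4) ^ Suc n = - 2 * catalan n"
proof (induction n)
  case 0
  then show ?case by (simp add: catalan_def)
next
  case (Suc n)
  let ?g = "\<lambda>k. (1 / 2 :: real) gchoose k"
  have "real (n + 2) * ?g (Suc (Suc n)) = (1 / 2 - real (Suc n)) * ?g (Suc n)"
    using gbinomial_mult_1[of "1 / 2 :: real" "Suc n"]
    by (simp add: field_simps)
  then have "real (n + 2) * (?g (Suc (Suc n)) * (- 4) ^ Suc (Suc n))
      = (1 / 2 - real (Suc n)) * ?g (Suc n) * (- 4) ^ Suc (Suc n)"
    by (simp only: flip: mult.assoc)
  also have "\<dots> = (1 / 2 - real (Suc n)) * (- 4) * (?g (Suc n) * (- 4) ^ Suc n)"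
    by (simp only: power_Suc mult_ac)
  also have "\<dots> = real (4 * n + 2) * (- 2 * catalan n)"
    unfolding Suc.IH by (simp add: algebra_simps)
  also have "\<dots> = real (n + 2) * (- 2 * catalan (Suc n))"
    using catalan_Suc[of n] by simp
  finally show ?case
    by (simp only: mult_cancel_left of_nat_eq_0_iff) simp
qed

text \<open>This is the binomial series of sqrt (1 - 2 y) without its constant term and with
  opposite sign. The weight 2^(-m) in the recursion turns the usual Catalan radicand 1 - 4 y into 1
  - 2 y.\<close>

lemma catalan_powser_sums:
  fixes y :: real
  assumes "\<bar>y\<bar> < 1 / 2"
  shows "(\<lambda>m. catalan m / 2 ^ m * y ^ Suc m) sums (1 - sqrt (1 - 2 * y))"
proof -
  have "(\<lambda>n. ((1 / 2 :: real) gchoose n) * (- 2 * y) ^ n) sums (1 + (- 2 * y)) powr (1 / 2)"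
    using assms by (intro gen_binomial_real) auto
  then have "(\<lambda>n. ((1 / 2 :: real) gchoose n) * (- 2 * y) ^ n) sums sqrt (1 - 2 * y)"
    using assms by (simp add: powr_half_sqrt)
  then have "(\<lambda>n. ((1 / 2 :: real) gchoose Suc n) * (- 2 * y) ^ Suc n) sums (sqrt (1 - 2 * y) - 1)"
    by (subst sums_Suc_iff) simp
  moreover have "((1 / 2 :: real) gchoose Suc n) * (- 2 * y) ^ Suc n
      = - (catalan n / 2 ^ n * y ^ Suc n)" for n
  proof -
    have "(- 2 * y) ^ Suc n = (- 4) ^ Suc n * (y / 2) ^ Suc n"
      by (simp flip: power_mult_distrib)
    then have "((1 / 2 :: real) gchoose Suc n) * (- 2 * y) ^ Suc n = - 2 * catalan n * (y / 2) ^ Suc n"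
      by (simp only: gbinomial_half_Suc_catalan flip: mult.assoc)
    then show ?thesis
      by (simp add: power_divide)
  qed
  ultimately show ?thesis
    using sums_minus by fastforce
qed

section \<open>The recursion on [0, 1]: continuity and positivity\<close>

definition V_coeff :: "nat \<Rightarrow> real \<Rightarrow> real" where
  "V_coeff m s = integral {0..s} (V_poly m) + catalan m / 2 ^ m * (1 - s) ^ Suc m"

lemma V_poly_Suc: "V_poly (Suc n) s = (\<Sum>m\<le>n. V_coeff m s * V_poly (n - m) s)"
  by (simp add: V_coeff_def atLeast0AtMost)

lemma continuous_on_V_poly: "continuous_on {0..1} (V_poly n)"
proof (induction n rule: less_induct)
  case (less n)
  show ?case
  proof (cases n)
    case 0
    then show ?thesis by simp
  next
    case (Suc k)
    have "continuous_on {0..1} (\<lambda>s. integral {0..s} (V_poly m))" if "m \<le> k" for m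
      using less that Suc by (intro indefinite_integral_continuous_1 integrable_continuous_interval) simp
    then show ?thesis
      unfolding Suc V_poly_Suc V_coeff_def using less Suc
      by (intro continuous_intros) auto
  qed
qed

lemma integrable_on_V_poly:
  assumes "s \<in> {0..1}" shows "V_poly n integrable_on {0..s}"
  using assms by (intro integrable_continuous_interval continuous_on_subset[OF continuous_on_V_poly]) auto

lemma V_poly_nonneg:
  assumes "s \<in> {0..1}" shows "0 \<le> V_poly n s"
  using assms
proof (induction n arbitrary: s rule: less_induct)
  case (less n)
  show ?case
  proof (cases n)
    case (Suc k)
    have "0 \<le> V_coeff m s" if "m \<le> k" for m
      unfolding V_coeff_def using less that Suc catalan_nonneg
      by (intro add_nonneg_nonneg integral_nonneg mult_nonneg_nonneg integrable_on_V_poly) auto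
    then show ?thesis
      unfolding Suc V_poly_Suc using less Suc by (intro sum_nonneg mult_nonneg_nonneg) auto
  qed auto
qed

lemma V_coeff_nonneg:
  assumes "s \<in> {0..1}" shows "0 \<le> V_coeff m s"
  unfolding V_coeff_def using assms catalan_nonneg V_poly_nonneg
  by (intro add_nonneg_nonneg integral_nonneg mult_nonneg_nonneg integrable_on_V_poly) auto

section \<open>The generating function and its integral equation\<close>

definition V_root :: "real \<Rightarrow> real \<Rightarrow> real" where
  "V_root z s = sqrt (1 - 2 * z * (1 - s))"

lemma V_radicand_pos:
  fixes z s :: real
  assumes "0 \<le> z" "z < 1 / 2" "s \<in> {0..1}" shows "0 < 1 - 2 * z * (1 - s)"
proof -
  have "z * (1 - s) \<le> z * 1" using assms by (intro mult_left_mono) auto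
  then show ?thesis using assms by simp
qed

lemma catalan_V_root_sums:
  assumes "0 \<le> z" "z < 1 / 2" "s \<in> {0..1}"
  shows "(\<lambda>m. z ^ Suc m * (catalan m / 2 ^ m * (1 - s) ^ Suc m)) sums (1 - V_root z s)"
proof -
  have "\<bar>z * (1 - s)\<bar> < 1 / 2"
    using V_radicand_pos[OF assms] assms by (simp add: abs_mult)
  from catalan_powser_sums[OF this] show ?thesis
    unfolding V_root_def by (simp only: power_mult_distrib mult_ac)
qed

text \<open>The triangle i + j <= N lies in the square, and the terms outside it are nonnegative.
  This allows a Cauchy product estimate for partial sums before any convergence is known.\<close>

lemma triangle_sum_le_product:
  fixes f g :: "nat \<Rightarrow> real"
  assumes "\<And>n. 0 \<le> f n" "\<And>n. 0 \<le> g n"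
  shows "(\<Sum>n\<le>N. \<Sum>m\<le>n. f m * g (n - m)) \<le> (\<Sum>m\<le>N. f m) * (\<Sum>k\<le>N. g k)"
proof -
  have "(\<Sum>n\<le>N. \<Sum>m\<le>n. f m * g (n - m)) = (\<Sum>(m, k)\<in>{(i, j). i + j \<le> N}. f m * g k)"
    using sum.triangle_reindex_eq[of "\<lambda>m k. f m * g k" N] by simp
  also have "\<dots> \<le> (\<Sum>(m, k)\<in>{..N} \<times> {..N}. f m * g k)"
    using assms by (intro sum_mono2) auto
  also have "\<dots> = (\<Sum>m\<le>N. f m) * (\<Sum>k\<le>N. g k)"
    by (simp add: sum.cartesian_product sum_product)
  finally show ?thesis .
qed

text \<open>Splitting z^(n+1) as z^(m+1) z^(n-m) exhibits the recursion as a Cauchy product, with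
  the extra factor z attached to \<open>V_coeff\<close>.\<close>

lemma V_poly_Suc_power:
  "z ^ Suc n * V_poly (Suc n) s = (\<Sum>m\<le>n. (z ^ Suc m * V_coeff m s) * (z ^ (n - m) * V_poly (n - m) s))"
proof -
  have "z ^ Suc n = z ^ Suc m * z ^ (n - m)" if "m \<le> n" for m
    using that by (simp flip: power_add)
  then show ?thesis
    unfolding V_poly_Suc sum_distrib_left by (intro sum.cong) (auto simp only: mult_ac atMost_iff)
qed

text \<open>Since all terms are nonnegative, the recursion bounds the partial sum up to N + 1 by the
  right side of the equation with the partial sum up to N in place of p. That right side is
  monotone, so the bound by p is inherited.\<close>

lemma V_poly_partial_sum_le:
  fixes p :: "real \<Rightarrow> real"
  assumes z: "0 \<le> z" "z < 1 / 2"
    and cont: "continuous_on {0..1} p"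
    and p: "\<And>s. s \<in> {0..1} \<Longrightarrow> p s = 1 + (z * integral {0..s} p + 1 - V_root z s) * p s"
    and p_ge: "\<And>s. s \<in> {0..1} \<Longrightarrow> 1 \<le> p s"
    and s: "s \<in> {0..1}"
  shows "(\<Sum>n\<le>N. z ^ n * V_poly n s) \<le> p s"
  using s
proof (induction N arbitrary: s)
  case 0
  then show ?case using p_ge by simp
next
  case (Suc N)
  have nonneg: "0 \<le> z ^ m * V_coeff k s" "0 \<le> z ^ m * V_poly k s" for m k
    using z Suc.prems by (simp_all add: V_coeff_nonneg V_poly_nonneg)
  have "(\<Sum>n\<le>Suc N. z ^ n * V_poly n s) = 1 + (\<Sum>n\<le>N. z ^ Suc n * V_poly (Suc n) s)"
    by (subst sum.atMost_Suc_shift) simp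
  also have "\<dots> \<le> 1 + (\<Sum>m\<le>N. z ^ Suc m * V_coeff m s) * (\<Sum>k\<le>N. z ^ k * V_poly k s)"
    unfolding V_poly_Suc_power using nonneg by (intro add_left_mono triangle_sum_le_product)
  also have "\<dots> \<le> 1 + (z * integral {0..s} p + 1 - V_root z s) * p s"
  proof (intro add_left_mono mult_mono)
    have "(\<Sum>m\<le>N. z ^ m * integral {0..s} (V_poly m)) = integral {0..s} (\<lambda>t. \<Sum>m\<le>N. z ^ m * V_poly m t)"
      using integrable_on_V_poly[OF Suc.prems] by (subst integral_sum) (auto intro: integrable_on_mult_right)
    also have "\<dots> \<le> integral {0..s} p"
      using Suc by (intro integral_le integrable_sum integrable_on_mult_right integrable_on_V_poly
          integrable_continuous_interval continuous_on_subset[OF cont]) auto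
    finally have "z * (\<Sum>m\<le>N. z ^ m * integral {0..s} (V_poly m)) \<le> z * integral {0..s} p"
      using z(1) by (rule mult_left_mono)
    \<comment> \<open>A finite sum of nonnegative terms lies below the limit of its series; padding
      it with zeros makes it a series that can be compared termwise.\<close>
    moreover have "(\<Sum>m\<le>N. z ^ Suc m * (catalan m / 2 ^ m * (1 - s) ^ Suc m)) \<le> 1 - V_root z s"
      using Suc.prems z catalan_nonneg
      by (intro sums_le[OF _ sums_If_finite_set catalan_V_root_sums]) auto
    ultimately show "(\<Sum>m\<le>N. z ^ Suc m * V_coeff m s) \<le> z * integral {0..s} p + 1 - V_root z s"
      unfolding V_coeff_def by (simp add: distrib_left sum.distrib sum_distrib_left mult_ac)
  next
    have "0 \<le> z * integral {0..s} p"
      using p_ge Suc.prems z by (intro mult_nonneg_nonneg integral_nonneg integrable_continuous_interval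
          continuous_on_subset[OF cont]) (auto intro: order_trans[OF zero_le_one])
    moreover have "V_root z s \<le> 1"
      unfolding V_root_def using z Suc.prems by simp
    ultimately show "0 \<le> z * integral {0..s} p + 1 - V_root z s" by simp
  qed (use Suc nonneg(2) in \<open>auto intro: sum_nonneg\<close>)
  also have "\<dots> = p s"
    using p[OF Suc.prems] by simp
  finally show ?case .
qed

text \<open>The bound at the larger parameter z1 gives the majorant M (z / z1)^n, which is
  independent of s. Convergence is therefore uniform on [0, 1], so the limit is continuous and may
  be integrated termwise.\<close>

lemma V_generating_function_equation:
  assumes z: "0 \<le> z" "z < z1" "z1 < 1 / 2"
    and bound: "\<And>s n. s \<in> {0..1} \<Longrightarrow> z1 ^ n * V_poly n s \<le> M"
  obtains f where "continuous_on {0..1} f"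
    "\<And>s. s \<in> {0..1} \<Longrightarrow> (\<lambda>n. z ^ n * V_poly n s) sums f s"
    "\<And>s. s \<in> {0..1} \<Longrightarrow> 1 \<le> f s"
    "\<And>s. s \<in> {0..1} \<Longrightarrow> f s = 1 + (z * integral {0..s} f + 1 - V_root z s) * f s"
proof
  define f where "f s = (\<Sum>n. z ^ n * V_poly n s)" for s
  have geo: "norm (z ^ n * V_poly n s) \<le> M * (z / z1) ^ n" if "s \<in> {0..1}" for n s
  proof -
    have "z ^ n * V_poly n s = (z1 ^ n * V_poly n s) * (z / z1) ^ n"
      using z by (simp add: power_divide)
    also have "\<dots> \<le> M * (z / z1) ^ n"
      using bound[OF that] z by (intro mult_right_mono) auto
    finally show ?thesis
      using V_poly_nonneg[OF that] z by simp
  qed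
  have geo_summable: "summable (\<lambda>n. M * (z / z1) ^ n)"
    using z by (intro summable_mult summable_geometric) auto
  have unif: "uniform_limit {0..1} (\<lambda>N s. \<Sum>n<N. z ^ n * V_poly n s) f sequentially"
    unfolding f_def by (rule Weierstrass_m_test[OF geo geo_summable])
  have summable_norm: "summable (\<lambda>n. norm (z ^ n * V_poly n s))" if "s \<in> {0..1}" for s
    using geo[OF that] by (intro summable_comparison_test[OF _ geo_summable]) auto
  show sums: "(\<lambda>n. z ^ n * V_poly n s) sums f s" if "s \<in> {0..1}" for s
    unfolding f_def by (intro summable_sums summable_norm_cancel[OF summable_norm[OF that]])
  show cont: "continuous_on {0..1} f"
    by (intro uniform_limit_theorem[OF _ unif]) (auto intro!: always_eventually continuous_intros continuous_on_V_poly)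
  fix s :: real assume s: "s \<in> {0..1}"
  have "(\<Sum>n<1. z ^ n * V_poly n s) \<le> f s"
    unfolding f_def using s z V_poly_nonneg
    by (intro sum_le_suminf sums_summable[OF sums]) auto
  then show "1 \<le> f s" by simp
  have "uniform_limit {0..s} (\<lambda>N t. \<Sum>n<N. z ^ n * V_poly n t) f sequentially"
    using s by (intro uniform_limit_on_subset[OF unif]) auto
  then obtain I J where "\<And>N. ((\<lambda>t. \<Sum>n<N. z ^ n * V_poly n t) has_integral I N) {0..s}"
      and "(f has_integral J) {0..s}" and "I \<longlonglongrightarrow> J"
    by (rule uniform_limit_integral)
      (use s in \<open>auto intro!: continuous_intros continuous_on_subset[OF continuous_on_V_poly]\<close>)
  then have "(\<lambda>N. integral {0..s} (\<lambda>t. \<Sum>n<N. z ^ n * V_poly n t)) \<longlonglongrightarrow> integral {0..s} f"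
    using integral_unique[of _ _ "{0..s}"] by (simp add: has_integral_integrable_integral)
  moreover have "integral {0..s} (\<lambda>t. \<Sum>n<N. z ^ n * V_poly n t) = (\<Sum>n<N. z ^ n * integral {0..s} (V_poly n))" for N
    using integrable_on_V_poly[OF s] by (subst integral_sum) (auto intro: integrable_on_mult_right)
  ultimately have "(\<lambda>n. z ^ n * integral {0..s} (V_poly n)) sums integral {0..s} f"
    by (simp add: sums_def)
  then have "(\<lambda>n. z * (z ^ n * integral {0..s} (V_poly n))) sums (z * integral {0..s} f)"
    by (rule sums_mult)
  from sums_add[OF this catalan_V_root_sums[OF z(1) _ s]] z
  have coeff_sums: "(\<lambda>m. z ^ Suc m * V_coeff m s) sums (z * integral {0..s} f + 1 - V_root z s)"
    unfolding V_coeff_def by (simp add: distrib_left mult_ac add_diff_eq)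
  have "summable (\<lambda>m. norm (z ^ Suc m * V_coeff m s))"
    using sums_summable[OF coeff_sums] V_coeff_nonneg[OF s] z(1) by (simp add: abs_mult)
  from Cauchy_product_sums[OF this summable_norm[OF s]]
  have "(\<lambda>n. z ^ Suc n * V_poly (Suc n) s) sums ((z * integral {0..s} f + 1 - V_root z s) * f s)"
    unfolding V_poly_Suc_power f_def[symmetric] sums_unique[OF coeff_sums, symmetric] .
  \<comment> \<open>The same series is that of f s without its term P_0 = 1.\<close>
  moreover have "(\<lambda>n. z ^ Suc n * V_poly (Suc n) s) sums (f s - 1)"
    using sums[OF s] by (subst sums_Suc_iff) simp
  ultimately show "f s = 1 + (z * integral {0..s} f + 1 - V_root z s) * f s"
    using sums_unique2 by fastforce
qed


section \<open>The function T0, its inverse and the critical parameter\<close>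

lemma T0_quadratic_pos: "0 < s\<^sup>2 - s + (1 :: real)"
proof -
  have "s\<^sup>2 - s + 1 = (s - 1 / 2)\<^sup>2 + 3 / 4"
    by (simp add: power2_eq_square algebra_simps)
  then show ?thesis
    using zero_le_power2[of "s - 1 / 2"] by linarith
qed

lemma DERIV_T0: "(T0 has_real_derivative - s / (s\<^sup>2 - s + 1)) (at s)"
proof -
  have pos: "0 < s\<^sup>2 - s + 1" by (rule T0_quadratic_pos)
  have eq: "1 + ((2 * s - 1) / sqrt 3)\<^sup>2 = 4 / 3 * (s\<^sup>2 - s + 1)"
    by (simp add: power_divide power2_eq_square field_simps)
  \<comment> \<open>With the quadratic abstracted to Q, the left side is -1 / (2 Q) - (2 s - 1) / (2
    Q).\<close>
  have "- (sqrt 3 / 3) * (2 / sqrt 3 * inverse (4 / 3 * Q)) - (2 * s - 1) / Q / 2 = - s / Q" if "0 < Q" for Q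
    using that by (simp add: field_simps)
  from this[OF pos, folded eq]
  have "- (sqrt 3 / 3) * (2 / sqrt 3 * inverse (1 + ((2 * s - 1) / sqrt 3)\<^sup>2)) - (2 * s - 1) / (s\<^sup>2 - s + 1) / 2
      = - s / (s\<^sup>2 - s + 1)" .
  moreover have "((\<lambda>s. - (sqrt 3 / 3) * (arctan ((2 * s - 1) / sqrt 3) - pi / 6)) has_real_derivative
      - (sqrt 3 / 3) * (2 / sqrt 3 * inverse (1 + ((2 * s - 1) / sqrt 3)\<^sup>2))) (at s)"
    by (auto intro!: derivative_eq_intros)
  moreover have "((\<lambda>s. ln (s\<^sup>2 - s + 1) / 2) has_real_derivative (2 * s - 1) / (s\<^sup>2 - s + 1) / 2) (at s)"
    using pos by (auto intro!: derivative_eq_intros simp: divide_simps) (simp add: algebra_simps)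
  ultimately show ?thesis
    unfolding T0_def[abs_def] by (simp only: DERIV_diff flip: \<open>_ = - s / (s\<^sup>2 - s + 1)\<close>)
qed

lemma isCont_T0: "isCont T0 s"
  using DERIV_T0 by (rule DERIV_isCont)

text \<open>The derivative vanishes at 0, so its sign is used on the open interval only, with
  continuity at the endpoints; this includes the case a = 0.\<close>

lemma T0_less:
  assumes "0 \<le> a" "a < b" shows "T0 b < T0 a"
proof (rule DERIV_neg_imp_decreasing_open[OF assms(2)])
  fix s assume "a < s" "s < b"
  then show "\<exists>y. (T0 has_real_derivative y) (at s) \<and> y < 0"
    using assms T0_quadratic_pos[of s] DERIV_T0[of s] by (intro exI[of _ "- s / (s\<^sup>2 - s + 1)"]) auto
qed (auto intro: continuous_at_imp_continuous_on isCont_T0)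

lemma T0_inv_T0:
  assumes "0 \<le> s" shows "T0_inv (T0 s) = s"
proof -
  have "inj_on T0 {0..}"
    by (intro linorder_inj_onI) (use T0_less in \<open>fastforce simp: le_less\<close>)+
  then show ?thesis
    unfolding T0_inv_def using assms by (intro inv_into_f_f) auto
qed

lemma T0_0: "T0 0 = sqrt 3 * pi / 9"
proof -
  have "arctan ((2 * 0 - 1) / sqrt 3) = - (pi / 6)"
    by (intro arctan_unique) (use pi_gt_zero in \<open>auto simp: tan_30 simp del: pi_gt_zero\<close>)
  then show ?thesis
    unfolding T0_def by simp
qed

lemma T0_1: "T0 1 = 0"
proof -
  have "arctan (1 / sqrt 3) = pi / 6"
    by (intro arctan_unique) (auto simp: tan_30)
  then show ?thesis
    by (simp add: T0_def)
qed

lemma T0_surj_on_interval: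
  assumes "0 \<le> b" "T0 b \<le> y" "y \<le> T0 0"
  obtains c where "0 \<le> c" "c \<le> b" "T0 c = y"
  using IVT2[of T0 b y 0] assms isCont_T0 by blast

text \<open>For c > 0 the derivative of T0 at c is nonzero, and c is interior to [0, 2 c]. Hence T0
  c is interior to the interval from T0 (2 c) to T0 0, on which \<open>T0_inv\<close> is a right
  inverse as well.\<close>

lemma DERIV_T0_inv:
  assumes "0 < c"
  shows "(T0_inv has_real_derivative - (c\<^sup>2 - c + 1) / c) (at (T0 c))"
proof -
  have "isCont T0_inv (T0 c)"
    using assms by (intro isCont_inverse_function2[of 0 c "2 * c" T0_inv T0] T0_inv_T0 isCont_T0) auto
  moreover have "T0 (T0_inv y) = y" if y: "T0 (2 * c) < y" "y < T0 0" for y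
  proof -
    obtain d where "0 \<le> d" "T0 d = y"
      using T0_surj_on_interval[of "2 * c" y] y assms by auto
    then show ?thesis using T0_inv_T0[of d] by simp
  qed
  ultimately have "(T0_inv has_real_derivative inverse (- c / (c\<^sup>2 - c + 1))) (at (T0 c))"
    using assms DERIV_T0[of c] T0_inv_T0[of c] T0_less[of c "2 * c"] T0_less[of 0 c] T0_quadratic_pos[of c]
    by (intro DERIV_inverse_function[where a = "T0 (2 * c)" and b = "T0 0" and f = T0]) auto
  then show ?thesis
    unfolding inverse_divide divide_minus_right minus_divide_left .
qed

text \<open>The exponent in \<open>gamma0\<close> is 2 T0 0. So 1 / (2 + gamma0) is the value of z
  at which - ln (1 - 2 z) / 2 reaches T0 0, the maximum of T0 on [0, \<infinity>).\<close>

lemma inverse_2_plus_gamma0: "1 / (2 + gamma0) = (1 - exp (- 2 * T0 0)) / 2"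
proof -
  have "1 < exp (2 * sqrt 3 * pi / 9)" by simp
  moreover have "- 2 * T0 0 = - (2 * sqrt 3 * pi / 9)" by (simp add: T0_0)
  ultimately show ?thesis
    unfolding gamma0_def by (simp add: exp_minus field_simps)
qed

lemma V_parameter_bound:
  assumes "z < 1 / (2 + gamma0)"
  shows "z < 1 / 2" "- ln (1 - 2 * z) / 2 < T0 0"
proof -
  have "exp (- 2 * T0 0) < 1 - 2 * z"
    using assms unfolding inverse_2_plus_gamma0 by simp
  moreover from this show "z < 1 / 2"
    using exp_gt_zero[of "- 2 * T0 0"] by linarith
  ultimately have "- 2 * T0 0 < ln (1 - 2 * z)"
    by (subst (asm) ln_less_cancel_iff[symmetric]) auto
  then show "- ln (1 - 2 * z) / 2 < T0 0" by simp
qed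

section \<open>Solving the integral equation\<close>

lemma V_root_pos:
  assumes "0 \<le> z" "z < 1 / 2" "s \<in> {0..1}" shows "0 < V_root z s"
  unfolding V_root_def using V_radicand_pos[OF assms] by simp

lemma V_root_power2:
  assumes "0 \<le> z" "z < 1 / 2" "s \<in> {0..1}" shows "(V_root z s)\<^sup>2 = 1 - 2 * z * (1 - s)"
  unfolding V_root_def using V_radicand_pos[OF assms] by simp

lemma DERIV_V_root:
  assumes "0 \<le> z" "z < 1 / 2" "s \<in> {0..1}"
  shows "(V_root z has_real_derivative z / V_root z s) (at s within A)"
  unfolding V_root_def using V_radicand_pos[OF assms]
  by (auto intro!: derivative_eq_intros simp: divide_simps)

lemma DERIV_ln_V_radicand:
  assumes "0 \<le> z" "z < 1 / 2" "s \<in> {0..1}"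
  shows "((\<lambda>s. ln (1 - 2 * z * (1 - s)) / 2) has_real_derivative z / (V_root z s)\<^sup>2) (at s within A)"
  unfolding V_root_power2[OF assms] using V_radicand_pos[OF assms]
  by (auto intro!: derivative_eq_intros simp: divide_simps)

text \<open>The explicit solution is p = 1 / (r u) with r = \<open>V_root z\<close> and u(s) =
  \<open>T0_inv (L s)\<close>. The bound on z is what keeps L(s) below T0 0, and thus u positive, on
  all of [0, 1].\<close>

lemma V_equation_solution:
  assumes z: "0 \<le> z" "z < 1 / (2 + gamma0)"
  obtains p where "continuous_on {0..1} p"
    "\<And>s. s \<in> {0..1} \<Longrightarrow> 1 \<le> p s"
    "\<And>s. s \<in> {0..1} \<Longrightarrow> p s = 1 + (z * integral {0..s} p + 1 - V_root z s) * p s"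
proof
  have z2: "z < 1 / 2" and max: "- ln (1 - 2 * z) / 2 < T0 0"
    using V_parameter_bound[OF z(2)] by auto
  \<comment> \<open>L increases from 0 at s = 0 to - ln (1 - 2 z) / 2 < T0 0 at s = 1, so its values
    have preimages under T0 in (0, 1].\<close>
  define L where "L s = ln (1 - 2 * z * (1 - s)) / 2 - ln (1 - 2 * z) / 2" for s
  define v where "v s = V_root z s * T0_inv (L s)" for s
  define p where "p s = 1 / v s" for s
  have u: "0 < T0_inv (L s)" "T0_inv (L s) \<le> 1" "T0 (T0_inv (L s)) = L s" if s: "s \<in> {0..1}" for s
  proof -
    have "1 - 2 * z \<le> 1 - 2 * z * (1 - s)"
      using z s by (simp add: algebra_simps)
    then have "0 \<le> L s"
      unfolding L_def using z2 by simp
    moreover have "L s < T0 0"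
    proof -
      have "ln (1 - 2 * z * (1 - s)) \<le> 0"
        using V_radicand_pos[OF z(1) z2 s] z s by simp
      then show ?thesis unfolding L_def using max by simp
    qed
    ultimately obtain c where c: "0 \<le> c" "c \<le> 1" "T0 c = L s"
      using T0_surj_on_interval[of 1 "L s"] T0_1 by auto
    moreover have "c \<noteq> 0" using c \<open>L s < T0 0\<close> by auto
    ultimately show "0 < T0_inv (L s)" "T0_inv (L s) \<le> 1" "T0 (T0_inv (L s)) = L s"
      using T0_inv_T0[of c] by auto
  qed
  have v: "0 < v s" "v s \<le> 1" if s: "s \<in> {0..1}" for s
  proof -
    have "V_root z s \<le> 1"
      unfolding V_root_def using z s by simp
    then show "0 < v s" "v s \<le> 1"
      unfolding v_def using u[OF s] V_root_pos[OF z(1) z2 s] by (auto intro: mult_le_one)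
  qed
  \<comment> \<open>This is the equation 1 / p = r - z * (integral of p) in differentiated form,
    because r' = z / r and v = 1 / p.\<close>
  have DERIV_v: "(v has_real_derivative z / V_root z s - z / v s) (at s within A)" if s: "s \<in> {0..1}" for s A
  proof -
    define u' where "u' = T0_inv (L s)"
    have "(L has_real_derivative z / (V_root z s)\<^sup>2) (at s within A)"
      unfolding L_def using DERIV_diff[OF DERIV_ln_V_radicand[OF z(1) z2 s, of A] DERIV_const] by simp
    moreover have "(T0_inv has_real_derivative - (u'\<^sup>2 - u' + 1) / u') (at (L s))"
      using DERIV_T0_inv[OF u(1)[OF s]] u(3)[OF s] unfolding u'_def by simp
    ultimately have "((\<lambda>s. T0_inv (L s)) has_real_derivative - (u'\<^sup>2 - u' + 1) / u' * (z / (V_root z s)\<^sup>2)) (at s within A)"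
      by (rule DERIV_chain2[rotated])
    from DERIV_mult[OF DERIV_V_root[OF z(1) z2 s, of A] this]
    have "(v has_real_derivative z / V_root z s * u' + - (u'\<^sup>2 - u' + 1) / u' * (z / (V_root z s)\<^sup>2) * V_root z s) (at s within A)"
      unfolding v_def u'_def .
    \<comment> \<open>With v = r u, the left side is (z / r) (u - (u^2 - u + 1) / u) = (z / r) (1 -
      1 / u).\<close>
    moreover have "z / V_root z s * u' + - (u'\<^sup>2 - u' + 1) / u' * (z / (V_root z s)\<^sup>2) * V_root z s
        = z / V_root z s - z / v s"
      using u(1)[OF s] V_root_pos[OF z(1) z2 s] unfolding v_def u'_def
      by (simp add: field_simps power2_eq_square)
    ultimately show ?thesis by simp
  qed
  then have "continuous_on {0..1} v"
    by (intro DERIV_continuous_on[of _ v]) blast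
  then show cont: "continuous_on {0..1} p"
    unfolding p_def using v by (intro continuous_intros) force+
  fix s :: real assume s: "s \<in> {0..1}"
  show "1 \<le> p s"
    unfolding p_def using v[OF s] by simp
  have "((\<lambda>t. z * p t) has_integral (V_root z s - v s) - (V_root z 0 - v 0)) {0..s}"
  proof (intro fundamental_theorem_of_calculus)
    fix t assume "t \<in> {0..s}"
    then have t: "t \<in> {0..1}" using s by auto
    have "((\<lambda>t. V_root z t - v t) has_real_derivative z * p t) (at t within {0..s})"
      using DERIV_diff[OF DERIV_V_root[OF z(1) z2 t] DERIV_v[OF t]] by (simp add: p_def)
    then show "((\<lambda>t. V_root z t - v t) has_vector_derivative z * p t) (at t within {0..s})"
      by (simp add: has_real_derivative_iff_has_vector_derivative)
  qed (use s in auto)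
  \<comment> \<open>The initial value is u(0) = \<open>T0_inv 0\<close> = 1, so the constant of
    integration vanishes.\<close>
  moreover have "v 0 = V_root z 0"
    using T0_inv_T0[of 1] T0_1 by (simp add: v_def L_def)
  ultimately have "z * integral {0..s} p = V_root z s - v s"
    by (simp add: integral_unique flip: integral_mult_right)
  then show "p s = 1 + (z * integral {0..s} p + 1 - V_root z s) * p s"
    using v[OF s] by (simp add: p_def field_simps)
qed

text \<open>This holds for any continuous solution f >= 1. The quotient w = 1 / (f r) satisfies w' =
  (z / r^2) (1 - 1 / w - w), so T0(w) has derivative z / r^2, as does ln (1 - 2 z (1 - s)) / 2.
  Their difference is constant, and comparing s = 0, where w = 1, with s = 1, where r = 1, gives the
  claim.\<close>

lemma T0_V_equation_solution:
  assumes z: "0 \<le> z" "z < 1 / 2"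
    and cont: "continuous_on {0..1} f"
    and f_ge: "\<And>s. s \<in> {0..1} \<Longrightarrow> 1 \<le> f s"
    and f: "\<And>s. s \<in> {0..1} \<Longrightarrow> f s = 1 + (z * integral {0..s} f + 1 - V_root z s) * f s"
  shows "T0 (1 / f 1) = - ln (1 - 2 * z) / 2"
proof -
  \<comment> \<open>Defining q by the integral formula makes it differentiable by the fundamental
    theorem of calculus; by the equation it equals 1 / f on [0, 1].\<close>
  define q where "q s = V_root z s - z * integral {0..s} f" for s
  have q: "q s = 1 / f s" if "s \<in> {0..1}" for s
    using f[OF that] f_ge[OF that] unfolding q_def by (simp add: field_simps)
  have "((\<lambda>s. T0 (q s / V_root z s) - ln (1 - 2 * z * (1 - s)) / 2) has_real_derivative 0) (at s within {0..1})"
    if s: "s \<in> {0..1}" for s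
  proof -
    define r where "r = V_root z s"
    define w where "w = q s / r"
    have pos: "0 < r" "0 < q s" "0 < w"
      using V_root_pos[OF z s] f_ge[OF s] q[OF s] unfolding r_def w_def by auto
    have "(q has_real_derivative z / r - z * f s) (at s within {0..1})"
      unfolding q_def r_def
      by (intro DERIV_diff DERIV_V_root[OF z s] DERIV_cmult integral_has_real_derivative[OF cont s])
    from DERIV_divide[OF this DERIV_V_root[OF z s]]
    have "((\<lambda>s. q s / V_root z s) has_real_derivative ((z / r - z * f s) * r - q s * (z / r)) / (r * r)) (at s within {0..1})"
      using pos unfolding r_def by simp
    also have "((z / r - z * f s) * r - q s * (z / r)) / (r * r) = z / r\<^sup>2 * (1 - 1 / w - w)"
    proof -
      have "f s = 1 / q s" using q[OF s] by simp
      then show ?thesis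
        using pos unfolding w_def by (simp add: field_simps power2_eq_square)
    qed
    finally have "((\<lambda>s. T0 (q s / V_root z s)) has_real_derivative
        - w / (w\<^sup>2 - w + 1) * (z / r\<^sup>2 * (1 - 1 / w - w))) (at s within {0..1})"
      unfolding w_def r_def by (rule DERIV_chain2[OF DERIV_T0])
    also have "- w / (w\<^sup>2 - w + 1) * (z / r\<^sup>2 * (1 - 1 / w - w)) = z / r\<^sup>2"
    proof -
      have "1 - 1 / w - w = - (w\<^sup>2 - w + 1) / w"
        using pos by (simp add: field_simps power2_eq_square)
      then show ?thesis
        using pos T0_quadratic_pos[of w] by (simp only: times_divide_times_eq) (simp add: divide_simps, simp add: algebra_simps)
    qed
    finally have "((\<lambda>s. T0 (q s / V_root z s)) has_real_derivative z / (V_root z s)\<^sup>2) (at s within {0..1})"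
      unfolding r_def .
    from DERIV_diff[OF this DERIV_ln_V_radicand[OF z s]] show ?thesis by simp
  qed
  from has_field_derivative_zero_constant[OF convex_real_interval(5) this]
  obtain c where c: "\<And>s. s \<in> {0..1} \<Longrightarrow> T0 (q s / V_root z s) - ln (1 - 2 * z * (1 - s)) / 2 = c"
    by blast
  have "q 0 = V_root z 0" "V_root z 0 > 0" "V_root z 1 = 1"
    using V_root_pos[OF z, of 0] by (auto simp: q_def V_root_def)
  then show ?thesis
    using c[of 0] c[of 1] q[of 1] by (simp add: T0_1)
qed

text \<open>An intermediate z1 is still below the threshold. The explicit solution at z1 is bounded
  on [0, 1] and dominates every z1^n P_n(s), which gives geometric convergence at z.\<close>

lemma V_poly_at_1_sums:
  assumes z: "0 \<le> z" "z < 1 / (2 + gamma0)"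
  obtains F where "1 \<le> F" "(\<lambda>n. z ^ n * V_poly n 1) sums F" "T0 (1 / F) = - ln (1 - 2 * z) / 2"
proof -
  obtain z1 where z1: "z < z1" "z1 < 1 / (2 + gamma0)"
    using z dense by blast
  then have z1': "0 \<le> z1" "z1 < 1 / 2"
    using z V_parameter_bound(1) by auto
  obtain p where p: "continuous_on {0..1} p" "\<And>s. s \<in> {0..1} \<Longrightarrow> 1 \<le> p s"
    "\<And>s. s \<in> {0..1} \<Longrightarrow> p s = 1 + (z1 * integral {0..s} p + 1 - V_root z1 s) * p s"
    using V_equation_solution[OF z1'(1) z1(2)] by metis
  obtain M where M: "\<And>s. s \<in> {0..1} \<Longrightarrow> p s \<le> M"
    using continuous_attains_sup[OF compact_Icc _ p(1)] by force
  have "z1 ^ n * V_poly n s \<le> M" if s: "s \<in> {0..1}" for s n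
  proof -
    have "z1 ^ n * V_poly n s \<le> (\<Sum>k\<le>n. z1 ^ k * V_poly k s)"
      using z1' V_poly_nonneg[OF s] by (intro member_le_sum) auto
    also have "\<dots> \<le> p s"
      by (rule V_poly_partial_sum_le[OF z1' p(1,3,2) s])
    finally show ?thesis using M[OF s] by simp
  qed
  with V_generating_function_equation[OF z(1) z1(1) z1'(2)]
  obtain f where f: "continuous_on {0..1} f"
    "\<And>s. s \<in> {0..1} \<Longrightarrow> (\<lambda>n. z ^ n * V_poly n s) sums f s"
    "\<And>s. s \<in> {0..1} \<Longrightarrow> 1 \<le> f s"
    "\<And>s. s \<in> {0..1} \<Longrightarrow> f s = 1 + (z * integral {0..s} f + 1 - V_root z s) * f s"
    by blast
  show ?thesis
    using that[of "f 1"] f T0_V_equation_solution[OF z(1) V_parameter_bound(1)[OF z(2)] f(1,3,4)] by simp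
qed

section \<open>The support of \<mu> and its Cauchy-Stieltjes transform\<close>

lemma standard_V_monotone_gaussian_AE_bound:
  assumes \<mu>: "standard_V_monotone_gaussian \<mu>"
    and z: "0 \<le> z" and lim: "(\<lambda>n. z ^ n * V_poly n 1) \<longlonglongrightarrow> 0"
  shows "AE t in \<mu>. z * t\<^sup>2 < 1"
proof -
  interpret real_distribution \<mu>
    using \<mu> by (simp add: standard_V_monotone_gaussian_def)
  have moments: "integrable \<mu> (\<lambda>t. t ^ n)" "(\<integral>t. t ^ n \<partial>\<mu>) = V_gaussian_moment n" for n
    using \<mu> by (auto simp: standard_V_monotone_gaussian_def)
  \<comment> \<open>Markov's inequality is applied to (z t^2)^n, whose mean is z^n times the moment
    of order 2 n, that is z^n P_n(1). The left side does not depend on n, so the limit n to infinity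
    forces it to be 0.\<close>
  have "prob {t. 1 \<le> z * t\<^sup>2} \<le> z ^ n * V_poly n 1" for n
  proof -
    have "prob {t. 1 \<le> z * t\<^sup>2} \<le> prob {t \<in> space \<mu>. 1 \<le> z ^ n * t ^ (2 * n)}"
    proof (intro finite_measure_mono)
      show "{t. 1 \<le> z * t\<^sup>2} \<subseteq> {t \<in> space \<mu>. 1 \<le> z ^ n * t ^ (2 * n)}"
        using one_le_power[of "z * _\<^sup>2" n] by (auto simp: power_mult_distrib power_mult)
    qed measurable
    also have "\<dots> \<le> (\<integral>t. z ^ n * t ^ (2 * n) \<partial>\<mu>) / 1"
      using z moments by (intro integral_Markov_inequality_measure[where A = "{}"]) auto
    also have "\<dots> = z ^ n * V_poly n 1"
      using moments(2)[of "2 * n"] by (simp add: V_gaussian_moment_def)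
    finally show ?thesis .
  qed
  with lim have "prob {t. 1 \<le> z * t\<^sup>2} \<le> 0"
    by (intro LIMSEQ_le_const) auto
  then have "prob {t \<in> space \<mu>. \<not> z * t\<^sup>2 < 1} = 0"
    by (simp add: not_less measure_le_0_iff)
  then show ?thesis
    by (subst (asm) prob_Collect_eq_0) auto
qed

theorem theorem2p4:
  fixes \<mu> :: "real measure" and x :: real
  assumes "standard_V_monotone_gaussian \<mu>"
    and "x \<in> - {- sqrt (2 + gamma0) .. sqrt (2 + gamma0)}"
  shows "x \<notin> measure_support \<mu> \<and>
         cauchy_stieltjes \<mu> (complex_of_real x) \<noteq> 0 \<and>
         reciprocal_cauchy_stieltjes \<mu> (complex_of_real x) = complex_of_real (x * T0_inv (W x))"
proof -
  interpret real_distribution \<mu>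
    using assms(1) by (simp add: standard_V_monotone_gaussian_def)
  have moments: "integrable \<mu> (\<lambda>t. t ^ n)" "(\<integral>t. t ^ n \<partial>\<mu>) = V_gaussian_moment n" for n
    using assms(1) by (auto simp: standard_V_monotone_gaussian_def)
  have gamma0: "0 < gamma0"
    by (simp add: gamma0_def)
  define z where "z = 1 / x\<^sup>2"
  have "sqrt (2 + gamma0) < \<bar>x\<bar>"
    using assms(2) by auto
  then have x2: "2 + gamma0 < x\<^sup>2"
    using gamma0 real_sqrt_less_iff[of "2 + gamma0" "x\<^sup>2"] by simp
  then have "x \<noteq> 0" using gamma0 by auto
  have z: "0 < z" "z < 1 / (2 + gamma0)"
    using x2 gamma0 \<open>x \<noteq> 0\<close> unfolding z_def by (auto intro: divide_strict_left_mono)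
  \<comment> \<open>The gap between z and z1 separates x from the support: almost surely |t| <= 1 /
    sqrt z1 < 1 / sqrt z = |x|.\<close>
  obtain z1 where z1: "z < z1" "z1 < 1 / (2 + gamma0)"
    using z dense by blast
  obtain F where F: "1 \<le> F" "(\<lambda>n. z ^ n * V_poly n 1) sums F" "T0 (1 / F) = - ln (1 - 2 * z) / 2"
    using V_poly_at_1_sums z by (metis less_imp_le)
  obtain F1 where "(\<lambda>n. z1 ^ n * V_poly n 1) sums F1"
    using V_poly_at_1_sums[of z1] z z1 by (metis less_imp_le less_trans)
  then have bound: "AE t in \<mu>. z1 * t\<^sup>2 < 1"
    using z z1 by (intro standard_V_monotone_gaussian_AE_bound[OF assms(1)]) (simp_all add: sums_summable summable_LIMSEQ_zero)
  have "x \<notin> measure_support \<mu>"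
  proof -
    have "AE t in \<mu>. \<not> 1 < z1 * t\<^sup>2"
      \<comment> \<open>The set where z1 t^2 > 1 is an open null set; it contains x because z1 > z =
        1 / x^2.\<close>
      using bound by eventually_elim simp
    from emeasure_eq_0_AE[OF this] have "emeasure \<mu> {t. 1 < z1 * t\<^sup>2} = 0"
      by simp
    moreover have "open {t. 1 < z1 * t\<^sup>2}"
      by (intro open_Collect_less continuous_intros)
    moreover have "1 < z1 * x\<^sup>2"
      using z1 \<open>x \<noteq> 0\<close> unfolding z_def by (simp add: divide_simps split: if_splits)
    ultimately show ?thesis
      unfolding measure_support_def by force
  qed
  define \<rho> where "\<rho> = 1 / sqrt z1"
  have \<rho>: "0 < \<rho>" "\<rho> < \<bar>x\<bar>"
  proof -
    show "0 < \<rho>" using z z1 by (simp add: \<rho>_def)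
    have "1 / sqrt z1 < 1 / sqrt z"
      using z z1 by (intro divide_strict_left_mono) auto
    then show "\<rho> < \<bar>x\<bar>"
      unfolding \<rho>_def z_def by (simp add: real_sqrt_divide)
  qed
  have AE_\<rho>: "AE t in \<mu>. \<bar>t\<bar> \<le> \<rho>"
    using bound
  proof eventually_elim
    case (elim t)
    then have "\<bar>t\<bar>\<^sup>2 \<le> \<rho>\<^sup>2"
      using z z1 by (simp add: \<rho>_def power_divide field_simps)
    then show ?case
      using \<rho> by (simp add: power2_le_iff_abs_le)
  qed
  \<comment> \<open>These are the terms of the geometric expansion of 1 / (x - t), valid for |t| <
    |x|.\<close>
  define g where "g n t = t ^ n / x ^ Suc n" for n and t :: real
  have integrable_g: "integrable \<mu> (g n)" for n
    unfolding g_def using moments by auto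
  have g_sums: "AE t in \<mu>. (\<lambda>n. g n t) sums (1 / (x - t)) \<and> summable (\<lambda>n. norm (g n t))"
    using AE_\<rho>
  proof eventually_elim
    case (elim t)
    have ratio: "norm (t / x) < 1"
      using elim \<rho> by (simp add: divide_simps)
    have "(\<lambda>n. 1 / x * (t / x) ^ n) sums (1 / x * (1 / (1 - t / x)))"
      by (intro sums_mult geometric_sums ratio)
    moreover have "1 / x * (1 / (1 - t / x)) = 1 / (x - t)"
      using elim \<rho> by (auto simp: field_simps)
    moreover have "summable (\<lambda>n. norm (1 / x) * norm (t / x) ^ n)"
      using ratio by (intro summable_mult summable_geometric) auto
    ultimately show ?case
      by (simp add: g_def power_divide abs_mult power_abs)
  qed
  \<comment> \<open>Geometric decay with ratio \<rho> / |x| < 1 justifies exchanging sum and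
    integral.\<close>
  have norm_g: "(\<integral>t. norm (g n t) \<partial>\<mu>) \<le> 1 / \<bar>x\<bar> * (\<rho> / \<bar>x\<bar>) ^ n" for n
  proof -
    have "(\<integral>t. norm (g n t) \<partial>\<mu>) \<le> (\<integral>t. 1 / \<bar>x\<bar> * (\<rho> / \<bar>x\<bar>) ^ n \<partial>\<mu>)"
    proof (intro integral_mono_AE)
      show "AE t in \<mu>. norm (g n t) \<le> 1 / \<bar>x\<bar> * (\<rho> / \<bar>x\<bar>) ^ n"
        using AE_\<rho>
        by eventually_elim (auto simp: g_def abs_mult power_abs power_divide intro!: divide_right_mono power_mono)
    qed (use integrable_g in auto)
    then show ?thesis
      using prob_space by simp
  qed
  have "(\<lambda>n. \<integral>t. g n t \<partial>\<mu>) sums (\<integral>t. (\<Sum>n. g n t) \<partial>\<mu>)"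
  proof (intro sums_integral integrable_g)
    show "AE t in \<mu>. summable (\<lambda>n. norm (g n t))"
      using g_sums by eventually_elim auto
    have "summable (\<lambda>n. 1 / \<bar>x\<bar> * (\<rho> / \<bar>x\<bar>) ^ n)"
      using \<rho> by (intro summable_mult summable_geometric) auto
    then show "summable (\<lambda>n. \<integral>t. norm (g n t) \<partial>\<mu>)"
    proof (rule summable_comparison_test'[where N = 0])
      show "norm (\<integral>t. norm (g n t) \<partial>\<mu>) \<le> 1 / \<bar>x\<bar> * (\<rho> / \<bar>x\<bar>) ^ n" for n
        using norm_g[of n] by (subst real_norm_def, subst abs_of_nonneg) auto
    qed
  qed
  also have "(\<integral>t. (\<Sum>n. g n t) \<partial>\<mu>) = (\<integral>t. 1 / (x - t) \<partial>\<mu>)"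
  proof (intro integral_cong_AE)
    show "AE t in \<mu>. (\<Sum>n. g n t) = 1 / (x - t)"
      using g_sums by eventually_elim (simp add: sums_iff)
  qed (auto simp: g_def)
  finally have "(\<lambda>n. V_gaussian_moment n / x ^ Suc n) sums (\<integral>t. 1 / (x - t) \<partial>\<mu>)"
    unfolding g_def using moments by simp
  \<comment> \<open>The odd moments vanish, so only the even indices contribute.\<close>
  then have "(\<lambda>n. V_gaussian_moment (2 * n) / x ^ Suc (2 * n)) sums (\<integral>t. 1 / (x - t) \<partial>\<mu>)"
    by (subst sums_mono_reindex[of "\<lambda>n. 2 * n"]) (auto simp: strict_mono_def V_gaussian_moment_def elim!: evenE)
  moreover have "(\<lambda>n. V_gaussian_moment (2 * n) / x ^ Suc (2 * n)) sums (F / x)"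
    using sums_divide[OF F(2), of x]
    by (simp add: V_gaussian_moment_def z_def power_divide power_mult[of x 2] mult.commute[of x])
  ultimately have "(\<integral>t. 1 / (x - t) \<partial>\<mu>) = F / x"
    by (rule sums_unique2)
  moreover have "cauchy_stieltjes \<mu> (complex_of_real x) = complex_of_real (\<integral>t. 1 / (x - t) \<partial>\<mu>)"
    unfolding cauchy_stieltjes_def by (subst integral_complex_of_real[symmetric]) simp
  ultimately have G: "cauchy_stieltjes \<mu> (complex_of_real x) = complex_of_real (F / x)"
    by simp
  \<comment> \<open>Taking logarithms, W x = - ln (1 - 2 z) / 2, which is the value of T0 at 1 /
    F.\<close>
  have "1 + 2 / (x\<^sup>2 - 2) = inverse (1 - 2 * z)"
    using x2 gamma0 \<open>x \<noteq> 0\<close> unfolding z_def by (simp add: field_simps)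
  then have "W x = T0 (1 / F)"
    using F(3) V_parameter_bound(1)[OF z(2)] by (simp add: W_def ln_inverse)
  then have "T0_inv (W x) = 1 / F"
    using T0_inv_T0[of "1 / F"] F(1) by simp
  then show ?thesis
    using G \<open>x \<notin> measure_support \<mu>\<close> \<open>x \<noteq> 0\<close> F(1) by (simp add: reciprocal_cauchy_stieltjes_def)
qed

end
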